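(* Let $X$ and $Y$ be separable Banach spaces. If $B_X$ is a slicely countably determined (SCD) set and $B_Y$ is the closed convex hull of its denting points, then $\operatorname{bc}(\mathcal L(X,Y^* ))=\operatorname{bc}(\mathcal L(Y,X^* ))=1$. In particular, $\mathcal L(X,Y^* )$ and $\mathcal L(Y,X^* )$ both have the ball-covering property (BCP).
   Context: All Banach spaces are real. $B_X$, $S_X$ denote the closed unit ball and the unit sphere; $B(x,r)$ is the open ball with center $x$ and radius $r>0$. $\mathcal L(X,Z)$ is the Banach space of bounded linear operators from $X$ to $Z$ with the operator norm. A slice of a bounded convex set $A$ is a non-empty intersection of $A$ with an open half-space. A bounded convex set $A$ is an SCD set if there is a sequence $(S_n)_{n\in\mathbb N}$ of slices of $A$ such that $A\subseteq\overline{\operatorname{conv}}\{b_n:n\in\mathbb N\}$ for every sequence $(b_n)$ with $b_n\in S_n$ for all $n$. A point $x$ of a bounded closed convex set $C$ is a denting point of $C$ if for every $\varepsilon>0$ there is a slice $S$ of $C$ with $x\in S$ and $\operatorname{diam}(S)<\varepsilon$. For $\alpha\in[-1,1)$, a Banach space $Z$ has the $\alpha$-BCP if there is a countable collection of open balls $\{B(z_n,r_n)\}$, $r_n>0$, with $S_Z\subset\bigcup_n B(z_n,r_n)$ and $\|z_n\|\ge r_n+\alpha$ for all $n$. The BCP is the $0$-BCP. The ball-covering index is $\operatorname{bc}(Z):=\sup\{\alpha\in[-1,1): Z\text{ has the }\alpha\text{-BCP}\}$ ($=-1$ if this set is empty). *)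

theory Defs
  imports "HOL-Analysis.Analysis"
begin

definition open_halfspace :: "'a::real_normed_vector set \<Rightarrow> bool" where
  "open_halfspace H \<longleftrightarrow> (\<exists>(f :: 'a \<Rightarrow>\<^sub>L real) c. f \<noteq> 0 \<and> H = {x. blinfun_apply f x > c})"

definition slice_of :: "'a::real_normed_vector set \<Rightarrow> 'a set \<Rightarrow> bool" where
  "slice_of A S \<longleftrightarrow> S \<noteq> {} \<and> (\<exists>H. open_halfspace H \<and> S = A \<inter> H)"

definition SCD_set :: "'a::real_normed_vector set \<Rightarrow> bool" where
  "SCD_set A \<longleftrightarrow> bounded A \<and> convex A \<and>
     (\<exists>S :: nat \<Rightarrow> 'a set. (\<forall>n. slice_of A (S n)) \<and>
        (\<forall>b :: nat \<Rightarrow> 'a. (\<forall>n. b n \<in> S n) \<longrightarrow> A \<subseteq> closure (convex hull (range b))))"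

definition denting_point :: "'a::real_normed_vector set \<Rightarrow> 'a \<Rightarrow> bool" where
  "denting_point C x \<longleftrightarrow> bounded C \<and> closed C \<and> convex C \<and> x \<in> C \<and>
     (\<forall>\<epsilon>>0. \<exists>S. slice_of C S \<and> x \<in> S \<and> diameter S < \<epsilon>)"

text \<open>A collection of balls is given as a countable set of pairs (centre, radius); the collection
  may be finite, and for the zero space, whose unit sphere is empty, it may be empty.\<close>

definition alpha_BCP :: "'z::banach itself \<Rightarrow> real \<Rightarrow> bool" where
  "alpha_BCP _ \<alpha> \<longleftrightarrow> (\<exists>B :: ('z \<times> real) set. countable B \<and>
     (\<forall>(z, r)\<in>B. r > 0 \<and> norm z \<ge> r + \<alpha>) \<and>
     sphere 0 1 \<subseteq> (\<Union>(z, r)\<in>B. ball z r))"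

abbreviation BCP :: "'z::banach itself \<Rightarrow> bool" where
  "BCP Z \<equiv> alpha_BCP Z 0"

text \<open>The case distinction is needed because \<open>Sup {}\<close> is unspecified on the reals.\<close>

definition bc :: "'z::banach itself \<Rightarrow> real" where
  "bc Z = (if {\<alpha> \<in> {-1..<1}. alpha_BCP Z \<alpha>} = {} then - 1
           else Sup {\<alpha> \<in> {-1..<1}. alpha_BCP Z \<alpha>})"

end

theory Submission
  imports Defs
begin

text \<open>Operators in \<open>\<L>(X, Y\<^sup>*)\<close> and \<open>\<L>(Y, X\<^sup>*)\<close> are bounded bilinear forms on \<open>X \<times> Y\<close>. If
  the form \<open>T\<close> of norm one satisfies \<open>T \<ge> \<beta>\<close> on a product of slices of \<open>B\<^sub>X\<close> and \<open>B\<^sub>Y\<close> cut out by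
  functionals \<open>f\<close> and \<open>g\<close>, then \<open>T\<close> lies within \<open>\<lambda>\<parallel>f\<parallel>\<parallel>g\<parallel> - \<beta>\<close> of \<open>\<lambda>(f \<otimes> g)\<close> for large \<open>\<lambda>\<close>: on the
  slices \<open>T\<close> and \<open>f \<otimes> g\<close> have the same sign, and off the slices \<open>f \<otimes> g\<close> stays away from its norm.
  So it suffices to find countably many slices of the two balls such that every \<open>T\<close> is at least \<open>\<beta>\<close>
  on the product of two of them. For \<open>B\<^sub>Y\<close> take small slices covering the denting points, which are
  norming (countably many suffice by the Lindelof property), and for \<open>B\<^sub>X\<close> take the slices of the
  SCD property: they determine the norm of every functional \<open>T(\<cdot>, y)\<close>.\<close>

section \<open>Countably many small slices around the denting points\<close>

text \<open>Balls of radius \<open>1 / (n + 1)\<close> about a countable dense set form a base.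
  Second countability then passes to the subspace of denting points and makes it Lindelof.\<close>

lemma separable_imp_second_countable_euclidean:
  assumes "separable_space (euclidean :: 'a::metric_space topology)"
  shows "second_countable (euclidean :: 'a topology)"
proof -
  obtain C :: "'a set" where C: "countable C" "closure C = UNIV"
    using assms unfolding separable_space_def by auto
  define B where "B = (\<lambda>(c, n). ball c (1 / real (Suc n))) ` (C \<times> (UNIV :: nat set))"
  have "\<exists>V\<in>B. x \<in> V \<and> V \<subseteq> U" if U: "open U" "x \<in> U" for U x
  proof -
    obtain e where e: "e > 0" "ball x e \<subseteq> U"
      using U open_contains_ball by blast
    obtain n where n: "1 / real (Suc n) < e / 2"
      using e nat_approx_posE by (metis half_gt_zero)
    have "x \<in> closure C" using C by simp
    then obtain c where c: "c \<in> C" "dist c x < 1 / real (Suc n)"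
      unfolding closure_approachable by (metis of_nat_0_less_iff zero_less_Suc zero_less_divide_1_iff)
    have "ball c (1 / real (Suc n)) \<subseteq> ball x e"
    proof
      fix z assume "z \<in> ball c (1 / real (Suc n))"
      then show "z \<in> ball x e"
        using c n dist_triangle[of x z c] by (simp add: dist_commute)
    qed
    then show ?thesis
      using c e by (intro bexI[of _ "ball c (1 / real (Suc n))"]) (auto simp: B_def)
  qed
  moreover have "countable B" "\<forall>V\<in>B. open V"
    using C by (auto simp: B_def)
  ultimately show ?thesis
    unfolding second_countable_def by (auto intro!: exI[of _ B])
qed

text \<open>The strict gap between threshold and norm later makes the scaling of the rank-one
  centres finite and positive.\<close>

lemma halfspace_meets_cball_imp_less_norm:
  fixes f :: "'a::real_normed_vector \<Rightarrow>\<^sub>L real"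
  assumes "cball 0 1 \<inter> {x. blinfun_apply f x > c} \<noteq> {}"
  shows "c < norm f"
proof -
  obtain x where x: "norm x \<le> 1" "c < blinfun_apply f x"
    using assms by auto
  have "blinfun_apply f x \<le> norm f * norm x"
    using norm_blinfun[of f x] by simp
  also have "\<dots> \<le> norm f"
    using x by (simp add: mult_left_le)
  finally show ?thesis using x by simp
qed

text \<open>Sublevel sets of a functional are closed and convex. Used contrapositively: a functional
  exceeding \<open>c\<close> somewhere on the closed hull exceeds it on \<open>S\<close>.\<close>

lemma closure_convex_hull_subset_sublevel:
  assumes "bounded_linear (f :: 'a::real_normed_vector \<Rightarrow> real)" and "\<And>x. x \<in> S \<Longrightarrow> f x \<le> c"
  shows "closure (convex hull S) \<subseteq> {x. f x \<le> c}"
proof (intro closure_minimal hull_minimal)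
  show "S \<subseteq> {x. f x \<le> c}" using assms by auto
  show "convex {x. f x \<le> c}"
    using convex_linear_vimage[OF bounded_linear.linear[OF assms(1)] convex_real_interval(2)[of c]]
    by (simp add: vimage_def)
  show "closed {x. f x \<le> c}"
    by (intro closed_Collect_le continuous_on_const linear_continuous_on assms)
qed

lemma countable_small_slices:
  assumes "separable_space (euclidean :: 'y::real_normed_vector topology)" and "\<epsilon> > 0"
  obtains Q :: "(('y::real_normed_vector \<Rightarrow>\<^sub>L real) \<times> real) set" where "countable Q"
    and "\<forall>(g, d)\<in>Q. g \<noteq> 0 \<and> d < norm g"
    and "\<forall>y. denting_point (cball 0 1) y \<longrightarrow> (\<exists>(g, d)\<in>Q. d < blinfun_apply g y \<and>
           (\<forall>y'. norm y' \<le> 1 \<longrightarrow> d < blinfun_apply g y' \<longrightarrow> dist y y' < \<epsilon>))"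
proof -
  define D where "D = {y :: 'y. denting_point (cball 0 1) y}"
  define H where "H = (\<lambda>(g :: 'y \<Rightarrow>\<^sub>L real, d). {y. d < blinfun_apply g y})"
  \<comment> \<open>These are all candidate slices. The covering uses the half-spaces
    \<open>H p\<close> that cut them out, because those are open in the whole space.\<close>
  define Q0 where "Q0 = {p. fst p \<noteq> 0 \<and> cball 0 1 \<inter> H p \<noteq> {} \<and> diameter (cball 0 1 \<inter> H p) < \<epsilon>}"
  have "Lindelof_space (subtopology euclidean D)"
    by (intro second_countable_imp_Lindelof_space second_countable_subtopology
        separable_imp_second_countable_euclidean assms)
  moreover have "open (H p)" for p
    by (cases p) (auto simp: H_def intro!: open_Collect_less continuous_intros)
  moreover have "D \<subseteq> \<Union>(H ` Q0)"
  proof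
    fix y assume "y \<in> D"
    then obtain S where S: "slice_of (cball 0 1) S" "y \<in> S" "diameter S < \<epsilon>"
      using assms(2) unfolding D_def denting_point_def by blast
    then obtain g d where "g \<noteq> 0" "S = cball 0 1 \<inter> H (g, d)"
      unfolding slice_of_def open_halfspace_def H_def by auto
    then show "y \<in> \<Union>(H ` Q0)"
      using S by (auto simp: Q0_def slice_of_def intro!: bexI[of _ "(g, d)"])
  qed
  ultimately obtain V where V: "countable V" "V \<subseteq> H ` Q0" "D \<subseteq> \<Union>V"
    unfolding Lindelof_space_subtopology_subset[OF subset_UNIV[of D, folded topspace_euclidean]]
    by (metis (no_types, lifting) imageE open_openin)
  then obtain Q where Q: "countable Q" "Q \<subseteq> Q0" "V = H ` Q"
    using countable_subset_image[of V H Q0] by blast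
  show ?thesis
  proof (rule that[OF Q(1)])
    show "\<forall>(g, d)\<in>Q. g \<noteq> 0 \<and> d < norm g"
      using Q by (force simp: Q0_def H_def intro!: halfspace_meets_cball_imp_less_norm)
    show "\<forall>y. denting_point (cball 0 1) y \<longrightarrow> (\<exists>(g, d)\<in>Q. d < blinfun_apply g y \<and>
           (\<forall>y'. norm y' \<le> 1 \<longrightarrow> d < blinfun_apply g y' \<longrightarrow> dist y y' < \<epsilon>))"
    proof (intro allI impI)
      fix y :: 'y assume y: "denting_point (cball 0 1) y"
      obtain p where p: "p \<in> Q" "y \<in> H p"
        using y V Q by (auto simp: D_def)
      have "norm y \<le> 1"
        using y by (simp add: denting_point_def)
      have "dist y y' < \<epsilon>" if "norm y' \<le> 1" "y' \<in> H p" for y'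
      proof -
        have "dist y y' \<le> diameter (cball 0 1 \<inter> H p)"
          using p that \<open>norm y \<le> 1\<close> by (intro diameter_bounded_bound) (auto simp: bounded_Int)
        also have "\<dots> < \<epsilon>"
          using p Q by (auto simp: Q0_def)
        finally show ?thesis .
      qed
      then show "\<exists>(g, d)\<in>Q. d < blinfun_apply g y \<and>
           (\<forall>y'. norm y' \<le> 1 \<longrightarrow> d < blinfun_apply g y' \<longrightarrow> dist y y' < \<epsilon>)"
        using p by (intro bexI[of _ p]) (auto simp: H_def)
    qed
  qed
qed

section \<open>Bilinear forms that are large on a product of slices\<close>

text \<open>First \<open>y0\<close> is replaced by a denting point \<open>y\<close>, then the SCD
  sequence gives a slice on which \<open>T x y\<close> stays large, and moving \<open>y\<close>
  within its small slice costs at most \<epsilon>. \<open>T\<close> is a plain function of two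
  arguments, so that an operator can be inserted with either variable first.\<close>

lemma bilinear_ge_on_slices:
  fixes S :: "nat \<Rightarrow> 'x::real_normed_vector set" and T :: "'x \<Rightarrow> 'y::real_normed_vector \<Rightarrow> real"
  assumes S: "\<forall>b. (\<forall>n. b n \<in> S n) \<longrightarrow> cball 0 1 \<subseteq> closure (convex hull (range b))"
    and S_ball: "\<And>n. S n \<subseteq> cball 0 1"
    and denting: "cball (0 :: 'y) 1 = closure (convex hull {y. denting_point (cball 0 1) y})"
    and Q: "\<forall>y. denting_point (cball 0 1) y \<longrightarrow> (\<exists>(g, d)\<in>Q. d < blinfun_apply g y \<and>
           (\<forall>y'. norm y' \<le> 1 \<longrightarrow> d < blinfun_apply g y' \<longrightarrow> dist y y' < \<epsilon>))"
    and lin: "\<And>x. bounded_linear (T x)" "\<And>y. bounded_linear (\<lambda>x. T x y)"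
    and bound: "\<And>x y. \<bar>T x y\<bar> \<le> norm x * norm y"
    and big: "norm x0 \<le> 1" "norm y0 \<le> 1" "T x0 y0 > \<beta> + \<epsilon>"
  shows "\<exists>n. \<exists>(g, d)\<in>Q. \<forall>x\<in>S n. \<forall>y. norm y \<le> 1 \<longrightarrow> d < blinfun_apply g y \<longrightarrow> T x y \<ge> \<beta>"
proof -
  have "\<exists>y. denting_point (cball 0 1) y \<and> T x0 y > \<beta> + \<epsilon>"
  proof (rule ccontr)
    assume "\<not> ?thesis"
    then have "closure (convex hull {y. denting_point (cball 0 1) y}) \<subseteq> {y. T x0 y \<le> \<beta> + \<epsilon>}"
      by (intro closure_convex_hull_subset_sublevel lin) auto
    moreover have "y0 \<in> cball 0 1" using big by simp
    ultimately show False using denting big by auto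
  qed
  then obtain y where y: "denting_point (cball 0 1) y" "T x0 y > \<beta> + \<epsilon>" by blast
  obtain g d where gd: "(g, d) \<in> Q"
    "\<And>y'. norm y' \<le> 1 \<Longrightarrow> d < blinfun_apply g y' \<Longrightarrow> dist y y' < \<epsilon>"
    using Q y(1) by auto
  have "\<exists>n. \<forall>x\<in>S n. T x y > \<beta> + \<epsilon>"
  proof (rule ccontr)
    \<comment> \<open>Otherwise each slice contributes a point where the functional is at most
      \<beta> + \<epsilon>, and the SCD property extends this bound to the whole ball, including
      \<open>x0\<close>.\<close>
    assume "\<not> ?thesis"
    then have "\<forall>n. \<exists>x. x \<in> S n \<and> T x y \<le> \<beta> + \<epsilon>" by (auto simp: not_less)
    then obtain b where b: "\<And>n. b n \<in> S n" "\<And>n. T (b n) y \<le> \<beta> + \<epsilon>" by metis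
    have "closure (convex hull (range b)) \<subseteq> {x. T x y \<le> \<beta> + \<epsilon>}"
      using b by (intro closure_convex_hull_subset_sublevel lin) auto
    moreover have "x0 \<in> cball 0 1" using big by simp
    ultimately show False using S b(1) y by force
  qed
  then obtain n where n: "\<And>x. x \<in> S n \<Longrightarrow> T x y > \<beta> + \<epsilon>" by blast
  have "T x y' \<ge> \<beta>" if "x \<in> S n" "norm y' \<le> 1" "d < blinfun_apply g y'" for x y'
  proof -
    have "T x y - T x y' = T x (y - y')"
      by (simp add: linear_diff[OF bounded_linear.linear[OF lin(1)]])
    also have "\<dots> \<le> norm x * norm (y - y')"
      using bound[of x "y - y'"] by simp
    also have "\<dots> \<le> norm (y - y')"
      using S_ball[of n] that(1) by (intro mult_left_le_one_le) auto
    also have "\<dots> \<le> \<epsilon>"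
      using gd(2)[OF that(2,3)] by (simp add: dist_norm)
    finally show ?thesis using n[OF that(1)] by simp
  qed
  then show ?thesis using gd(1) by blast
qed

section \<open>Operators into a dual space as bilinear forms\<close>

lemma bounded_linear_blinfun2_left: "bounded_linear (\<lambda>x. blinfun_apply (blinfun_apply T x) y)"
  by (rule bounded_linear_compose[OF blinfun.bounded_linear_left blinfun.bounded_linear_right])

lemma abs_blinfun2_le:
  fixes T :: "'a::real_normed_vector \<Rightarrow>\<^sub>L ('b::real_normed_vector \<Rightarrow>\<^sub>L real)"
  shows "\<bar>blinfun_apply (blinfun_apply T x) y\<bar> \<le> norm T * norm x * norm y"
  using norm_blinfun[of "blinfun_apply T x" y] norm_blinfun[of T x]
  by (simp add: order.trans[OF _ mult_right_mono])

text \<open>Replacing \<open>y\<close> by \<open>-y\<close> makes the one-sided bound two-sided, and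
  homogeneity extends it from the unit balls to all vectors.\<close>

lemma norm_blinfun2_le:
  fixes T :: "'a::real_normed_vector \<Rightarrow>\<^sub>L ('b::real_normed_vector \<Rightarrow>\<^sub>L real)"
  assumes le: "\<And>x y. norm x \<le> 1 \<Longrightarrow> norm y \<le> 1 \<Longrightarrow> blinfun_apply (blinfun_apply T x) y \<le> c"
  shows "norm T \<le> c"
proof -
  have "c \<ge> 0" using le[of 0 0] by simp
  have "\<bar>blinfun_apply (blinfun_apply T x) y\<bar> \<le> c * norm x * norm y" for x y
  proof (cases "x = 0 \<or> y = 0")
    case False
    have "blinfun_apply (blinfun_apply T (sgn x)) (sgn y) \<le> c"
      "blinfun_apply (blinfun_apply T (sgn x)) (- sgn y) \<le> c"
      by (rule le; simp add: norm_sgn)+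
    then have "\<bar>blinfun_apply (blinfun_apply T (sgn x)) (sgn y)\<bar> \<le> c"
      by (simp add: blinfun.minus_right)
    then show ?thesis
      using False by (simp add: sgn_div_norm blinfun.scaleR_right blinfun.scaleR_left abs_mult
          field_simps)
  qed auto
  then show ?thesis
    using \<open>c \<ge> 0\<close> by (intro norm_blinfun_bound) auto
qed

text \<open>The elementary tensor of \<open>f\<close> and \<open>g\<close>; its multiples are the
  centres of the covering balls.\<close>

definition rank_one :: "('a::real_normed_vector \<Rightarrow>\<^sub>L real) \<Rightarrow> ('b::real_normed_vector \<Rightarrow>\<^sub>L real) \<Rightarrow>
    'a \<Rightarrow>\<^sub>L ('b \<Rightarrow>\<^sub>L real)" where
  "rank_one f g = blinfun_scaleR_left g o\<^sub>L f"

lemma rank_one_apply [simp]: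
  "blinfun_apply (blinfun_apply (rank_one f g) x) y = blinfun_apply f x * blinfun_apply g y"
  by (simp add: rank_one_def blinfun.scaleR_left)

lemma norm_rank_one_ge: "norm f * norm g \<le> norm (rank_one f g)"
proof (cases "g = 0")
  case False
  have "norm f \<le> norm (rank_one f g) / norm g"
  proof (rule norm_blinfun_bound)
    fix x
    show "norm (blinfun_apply f x) \<le> norm (rank_one f g) / norm g * norm x"
      using norm_blinfun[of "rank_one f g" x] False by (simp add: rank_one_def field_simps)
  qed simp
  then show ?thesis using False by (simp add: field_simps)
qed simp

section \<open>Ball coverings built from slices\<close>

lemma alpha_BCP_of_slices:
  fixes P :: "(('x::banach \<Rightarrow>\<^sub>L real) \<times> real) set" and Q :: "(('y::banach \<Rightarrow>\<^sub>L real) \<times> real) set"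
  assumes "countable P" "countable Q"
    and P: "\<forall>(f, c)\<in>P. f \<noteq> 0 \<and> c < norm f"
    and Q: "\<forall>(g, d)\<in>Q. g \<noteq> 0 \<and> d < norm g"
    and slices: "\<And>T :: 'x \<Rightarrow>\<^sub>L ('y \<Rightarrow>\<^sub>L real). norm T = 1 \<Longrightarrow> \<exists>(f, c)\<in>P. \<exists>(g, d)\<in>Q.
          \<forall>x y. norm x \<le> 1 \<longrightarrow> norm y \<le> 1 \<longrightarrow> c < blinfun_apply f x \<longrightarrow> d < blinfun_apply g y \<longrightarrow>
            \<beta> \<le> blinfun_apply (blinfun_apply T x) y"
    and "\<alpha> < \<beta>" "\<beta> < 1"
  shows "alpha_BCP TYPE('x \<Rightarrow>\<^sub>L ('y \<Rightarrow>\<^sub>L real)) \<alpha>"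
proof -
  \<comment> \<open>if \<open>\<bar>f x\<bar> \<bar>g y\<bar> > q\<close> on the unit balls, then \<open>x\<close> and \<open>y\<close> lie, up to sign, in both slices\<close>
  define q :: "'x \<Rightarrow>\<^sub>L real \<Rightarrow> real \<Rightarrow> 'y \<Rightarrow>\<^sub>L real \<Rightarrow> real \<Rightarrow> real"
    where "q f c g d = max (max c 0 * norm g) (max d 0 * norm f)" for f c g d
  \<comment> \<open>Chosen so that \<open>l * q + 2 = l * (norm f * norm g)\<close>. The surplus 2
    exceeds 1 + \<beta>, which is what is needed where \<open>T\<close> is only known to be at least
    -1.\<close>
  define l where "l f c g d = 2 / (norm f * norm g - q f c g d)" for f c g d
  \<comment> \<open>Taking \<alpha> off the radius ensures that the norm of the centre is at least
    radius plus \<alpha>. The distance to \<open>T\<close> will be bounded with \<beta> in its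
    place, so \<alpha> < \<beta> puts \<open>T\<close> inside the open ball.\<close>
  define ctr where "ctr = (\<lambda>((f, c), (g, d)).
    (l f c g d *\<^sub>R rank_one f g, l f c g d * (norm f * norm g) - \<alpha>))"
  have q: "0 \<le> q f c g d" "q f c g d < norm f * norm g"
    and l: "0 < l f c g d" "l f c g d * q f c g d + 2 = l f c g d * (norm f * norm g)"
    if "(f, c) \<in> P" "(g, d) \<in> Q" for f c g d
  proof -
    have cd: "c < norm f" "d < norm g" "norm f > 0" "norm g > 0" using P Q that by auto
    show "0 \<le> q f c g d" by (simp add: q_def le_max_iff_disj)
    show "q f c g d < norm f * norm g"
      using cd by (auto simp: q_def max_def mult.commute)
    then show "0 < l f c g d" "l f c g d * q f c g d + 2 = l f c g d * (norm f * norm g)"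
      by (simp_all add: l_def field_simps)
  qed
  have radius: "0 < l f c g d * (norm f * norm g) - \<alpha>" if "(f, c) \<in> P" "(g, d) \<in> Q" for f c g d
  proof -
    have "0 \<le> l f c g d * q f c g d"
      using q(1)[OF that] l(1)[OF that] by simp
    then show ?thesis using l(2)[OF that] assms by linarith
  qed
  have centre: "l f c g d * (norm f * norm g) \<le> norm (l f c g d *\<^sub>R rank_one f g)"
    if "(f, c) \<in> P" "(g, d) \<in> Q" for f c g d
    using l(1)[OF that] norm_rank_one_ge[of f g] by simp
  have cover: "\<exists>p\<in>P \<times> Q. dist (fst (ctr p)) T < snd (ctr p)" if T: "norm T = 1" for T
  proof -
    obtain f c g d where fc: "(f, c) \<in> P" and gd: "(g, d) \<in> Q"
      and ge: "\<And>x y. norm x \<le> 1 \<Longrightarrow> norm y \<le> 1 \<Longrightarrow> c < blinfun_apply f x \<Longrightarrow>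
        d < blinfun_apply g y \<Longrightarrow> \<beta> \<le> blinfun_apply (blinfun_apply T x) y"
      using slices[OF T] by blast
    define L where "L = l f c g d"
    note L = l[OF fc gd, folded L_def]
    have "norm (L *\<^sub>R rank_one f g - T) \<le> L * (norm f * norm g) - \<beta>"
    proof (rule norm_blinfun2_le)
      fix x :: 'x and y :: 'y assume xy: "norm x \<le> 1" "norm y \<le> 1"
      define a b t where "a = blinfun_apply f x" and "b = blinfun_apply g y"
        and "t = blinfun_apply (blinfun_apply T x) y"
      have a: "\<bar>a\<bar> \<le> norm f"
        using norm_blinfun[of f x] xy mult_left_le[of "norm x" "norm f"] by (simp add: a_def)
      have b: "\<bar>b\<bar> \<le> norm g"
        using norm_blinfun[of g y] xy mult_left_le[of "norm y" "norm g"] by (simp add: b_def)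
      have "L * (a * b) - t \<le> L * (norm f * norm g) - \<beta>"
      proof (cases "a * b \<le> q f c g d")
        case True
        have "\<bar>t\<bar> \<le> 1"
          using abs_blinfun2_le[of T x y] T xy mult_le_one[of "norm x" "norm y"]
          by (simp add: t_def)
        moreover have "L * (a * b) \<le> L * q f c g d"
          using True L by simp
        ultimately show ?thesis using L assms by linarith
      next
        case False
        \<comment> \<open>The maxima with 0 keep \<open>q\<close> nonnegative even for negative
          thresholds, so here \<open>a\<close> and \<open>b\<close> are nonzero with equal
          signs.\<close>
        then have pos: "a * b > 0" and "a * b > max c 0 * norm g" "a * b > max d 0 * norm f"
          using q(1)[OF fc gd] by (auto simp: q_def)
        moreover have "a * b \<le> \<bar>a\<bar> * norm g" "a * b \<le> \<bar>b\<bar> * norm f"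
          "a * b \<le> norm f * norm g"
          using abs_ge_self[of "a * b"] mult_left_mono[OF b, of "\<bar>a\<bar>"]
            mult_left_mono[OF a, of "\<bar>b\<bar>"] mult_mono[OF a b]
          by (simp_all add: abs_mult mult.commute[of "\<bar>b\<bar>"])
        ultimately have "max c 0 * norm g < \<bar>a\<bar> * norm g" "max d 0 * norm f < \<bar>b\<bar> * norm f"
          by linarith+
        then have ab: "c < \<bar>a\<bar>" "d < \<bar>b\<bar>"
          by (auto simp: mult_less_cancel_right)
        have "\<beta> \<le> t"
        proof (cases "a > 0")
          case True
          then show ?thesis
            using ge[OF xy] pos ab by (auto simp: zero_less_mult_iff a_def b_def t_def)
        next
          case False
          \<comment> \<open>Both values are negative, so \<open>(-x, -y)\<close> lies in the product
            of the slices, and the form takes the same value there.\<close>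
          then show ?thesis
            using ge[of "- x" "- y"] xy pos ab
            by (auto simp: zero_less_mult_iff a_def b_def t_def blinfun.minus_right
                blinfun.minus_left)
        qed
        moreover have "L * (a * b) \<le> L * (norm f * norm g)"
          using L \<open>a * b \<le> norm f * norm g\<close> by simp
        ultimately show ?thesis by linarith
      qed
      then show "blinfun_apply (blinfun_apply (L *\<^sub>R rank_one f g - T) x) y
          \<le> L * (norm f * norm g) - \<beta>"
        by (simp add: blinfun.diff_left blinfun.scaleR_left a_def b_def t_def)
    qed
    then show ?thesis
      using fc gd \<open>\<alpha> < \<beta>\<close>
      by (intro bexI[of _ "((f, c), (g, d))"]) (auto simp: ctr_def L_def dist_norm)
  qed
  show ?thesis
    unfolding alpha_BCP_def
  proof (intro exI[of _ "ctr ` (P \<times> Q)"] conjI)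
    show "countable (ctr ` (P \<times> Q))" using assms by simp
    show "\<forall>(z, r)\<in>ctr ` (P \<times> Q). 0 < r \<and> r + \<alpha> \<le> norm z"
      using radius centre by (auto simp: ctr_def simp del: norm_scaleR)
    show "sphere 0 1 \<subseteq> (\<Union>(z, r)\<in>ctr ` (P \<times> Q). ball z r)"
      using cover by (force simp: case_prod_beta)
  qed
qed

section \<open>The ball-covering index of the two operator spaces\<close>

lemma bc_eq_1_and_BCP:
  assumes "\<And>\<alpha>. \<alpha> < 1 \<Longrightarrow> alpha_BCP TYPE('z::banach) \<alpha>"
  shows "bc TYPE('z) = 1 \<and> BCP TYPE('z)"
proof -
  have "{\<alpha> \<in> {-1..<1}. alpha_BCP TYPE('z) \<alpha>} = {-1..<1}"
    using assms by auto
  then show ?thesis using assms by (simp add: bc_def)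
qed

theorem theorem4p1:
  assumes "separable_space (euclidean :: 'x::banach topology)"
    and "separable_space (euclidean :: 'y::banach topology)"
    and "SCD_set (cball (0 :: 'x) 1)"
    and "cball (0 :: 'y) 1 = closure (convex hull {y. denting_point (cball 0 1) y})"
  shows "bc TYPE('x \<Rightarrow>\<^sub>L ('y \<Rightarrow>\<^sub>L real)) = 1 \<and> bc TYPE('y \<Rightarrow>\<^sub>L ('x \<Rightarrow>\<^sub>L real)) = 1 \<and>
    BCP TYPE('x \<Rightarrow>\<^sub>L ('y \<Rightarrow>\<^sub>L real)) \<and> BCP TYPE('y \<Rightarrow>\<^sub>L ('x \<Rightarrow>\<^sub>L real))"
proof -
  obtain S :: "nat \<Rightarrow> 'x set" where slice: "\<And>n. slice_of (cball 0 1) (S n)"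
    and SCD: "\<forall>b. (\<forall>n. b n \<in> S n) \<longrightarrow> cball 0 1 \<subseteq> closure (convex hull (range b))"
    using assms(3) unfolding SCD_set_def by blast
  have "\<exists>(f :: 'x \<Rightarrow>\<^sub>L real) c. f \<noteq> 0 \<and> (\<forall>x. x \<in> S n \<longleftrightarrow> norm x \<le> 1 \<and> blinfun_apply f x > c)"
    for n
  proof -
    obtain f :: "'x \<Rightarrow>\<^sub>L real" and c where "f \<noteq> 0" "S n = cball 0 1 \<inter> {x. blinfun_apply f x > c}"
      using slice[of n] by (auto simp: slice_of_def open_halfspace_def)
    then show ?thesis by (intro exI[of _ f] exI[of _ c]) simp
  qed
  then obtain f :: "nat \<Rightarrow> 'x \<Rightarrow>\<^sub>L real" and c where f: "\<And>n. f n \<noteq> 0"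
    and S: "\<And>n x. x \<in> S n \<longleftrightarrow> norm x \<le> 1 \<and> blinfun_apply (f n) x > c n"
    by metis
  have S_ball: "\<And>n. S n \<subseteq> cball 0 1" using S by auto
  define P where "P = range (\<lambda>n. (f n, c n))"
  have "c n < norm (f n)" for n
  proof (rule halfspace_meets_cball_imp_less_norm)
    obtain x where "x \<in> S n" using slice[of n] by (auto simp: slice_of_def)
    then show "cball 0 1 \<inter> {x. c n < blinfun_apply (f n) x} \<noteq> {}" by (auto simp: S)
  qed
  then have P: "countable P" "\<forall>(f, c)\<in>P. f \<noteq> 0 \<and> c < norm f"
    using f by (auto simp: P_def)
  have "alpha_BCP TYPE('x \<Rightarrow>\<^sub>L ('y \<Rightarrow>\<^sub>L real)) \<alpha> \<and> alpha_BCP TYPE('y \<Rightarrow>\<^sub>L ('x \<Rightarrow>\<^sub>L real)) \<alpha>"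
    if "\<alpha> < 1" for \<alpha>
  proof -
    \<comment> \<open>A third of the gap below 1 leaves room for \<alpha> < \<beta>, for the loss
      \<epsilon> inside a small slice, and for \<beta> + \<epsilon> < 1, so that every
      \<open>T\<close> of norm one exceeds \<beta> + \<epsilon> somewhere.\<close>
    define \<epsilon> where "\<epsilon> = (1 - \<alpha>) / 3"
    define \<beta> where "\<beta> = \<alpha> + \<epsilon>"
    have eps: "\<epsilon> > 0" "\<alpha> < \<beta>" "\<beta> < 1" "\<beta> + \<epsilon> < 1"
      using that by (auto simp: \<epsilon>_def \<beta>_def field_simps)
    obtain Q :: "(('y \<Rightarrow>\<^sub>L real) \<times> real) set" where Q: "countable Q"
      "\<forall>(g, d)\<in>Q. g \<noteq> 0 \<and> d < norm g"
      and dent: "\<forall>y. denting_point (cball 0 1) y \<longrightarrow> (\<exists>(g, d)\<in>Q. d < blinfun_apply g y \<and>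
           (\<forall>y'. norm y' \<le> 1 \<longrightarrow> d < blinfun_apply g y' \<longrightarrow> dist y y' < \<epsilon>))"
      by (fact countable_small_slices[OF assms(2) eps(1)])
    have slices: "\<exists>(f, c)\<in>P. \<exists>(g, d)\<in>Q. \<forall>x y. norm x \<le> 1 \<longrightarrow> norm y \<le> 1 \<longrightarrow>
        c < blinfun_apply f x \<longrightarrow> d < blinfun_apply g y \<longrightarrow> \<beta> \<le> T x y"
      if T: "\<And>x. bounded_linear (T x)" "\<And>y. bounded_linear (\<lambda>x. T x y)"
        "\<And>x y. \<bar>T x y\<bar> \<le> norm x * norm y"
        "\<exists>x y. norm x \<le> 1 \<and> norm y \<le> 1 \<and> T x y > \<beta> + \<epsilon>" for T
    proof -
      obtain x0 y0 where xy: "norm x0 \<le> 1" "norm y0 \<le> 1" "T x0 y0 > \<beta> + \<epsilon>"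
        using T(4) by blast
      have "\<exists>n. \<exists>(g, d)\<in>Q. \<forall>x\<in>S n. \<forall>y. norm y \<le> 1 \<longrightarrow> d < blinfun_apply g y \<longrightarrow> T x y \<ge> \<beta>"
        by (rule bilinear_ge_on_slices[OF SCD S_ball assms(4) dent T(1-3) xy])
      then obtain n g d where "(g, d) \<in> Q"
        "\<And>x y. x \<in> S n \<Longrightarrow> norm y \<le> 1 \<Longrightarrow> d < blinfun_apply g y \<Longrightarrow> T x y \<ge> \<beta>"
        by blast
      then show ?thesis
        unfolding P_def by (intro bexI[of _ "(f n, c n)"]) (auto simp: S intro!: bexI[of _ "(g, d)"])
    qed
    have big: "\<exists>x y. norm x \<le> 1 \<and> norm y \<le> 1 \<and> blinfun_apply (blinfun_apply T x) y > \<beta> + \<epsilon>"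
      if "norm T = 1" for T :: "'a::real_normed_vector \<Rightarrow>\<^sub>L ('b::real_normed_vector \<Rightarrow>\<^sub>L real)"
    proof (rule ccontr)
      assume "\<not> ?thesis"
      then have "norm T \<le> \<beta> + \<epsilon>"
        by (intro norm_blinfun2_le) (auto simp: not_less)
      then show False using that eps by simp
    qed
    have "alpha_BCP TYPE('x \<Rightarrow>\<^sub>L ('y \<Rightarrow>\<^sub>L real)) \<alpha>"
    proof (rule alpha_BCP_of_slices[OF P(1) Q(1) P(2) Q(2) _ eps(2,3)])
      fix T :: "'x \<Rightarrow>\<^sub>L ('y \<Rightarrow>\<^sub>L real)" assume T: "norm T = 1"
      show "\<exists>(f, c)\<in>P. \<exists>(g, d)\<in>Q. \<forall>x y. norm x \<le> 1 \<longrightarrow> norm y \<le> 1 \<longrightarrow>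
          c < blinfun_apply f x \<longrightarrow> d < blinfun_apply g y \<longrightarrow>
          \<beta> \<le> blinfun_apply (blinfun_apply T x) y"
        using abs_blinfun2_le[of T] T big[OF T]
        by (intro slices[of "\<lambda>x. blinfun_apply (blinfun_apply T x)"] blinfun.bounded_linear_right
            bounded_linear_blinfun2_left) auto
    qed
    moreover have "alpha_BCP TYPE('y \<Rightarrow>\<^sub>L ('x \<Rightarrow>\<^sub>L real)) \<alpha>"
    proof (rule alpha_BCP_of_slices[OF Q(1) P(1) Q(2) P(2) _ eps(2,3)])
      fix T :: "'y \<Rightarrow>\<^sub>L ('x \<Rightarrow>\<^sub>L real)" assume T: "norm T = 1"
      \<comment> \<open>The arguments of \<open>T\<close> are swapped: the form still has its SCD
        variable first, although the operator acts on the other space.\<close>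
      have "\<exists>(f, c)\<in>P. \<exists>(g, d)\<in>Q. \<forall>x y. norm x \<le> 1 \<longrightarrow> norm y \<le> 1 \<longrightarrow>
          c < blinfun_apply f x \<longrightarrow> d < blinfun_apply g y \<longrightarrow>
          \<beta> \<le> blinfun_apply (blinfun_apply T y) x"
        using abs_blinfun2_le[of T] T big[OF T]
        by (intro slices[of "\<lambda>x y. blinfun_apply (blinfun_apply T y) x"]
            blinfun.bounded_linear_right bounded_linear_blinfun2_left) (auto simp: mult.commute)
      then show "\<exists>(g, d)\<in>Q. \<exists>(f, c)\<in>P. \<forall>y x. norm y \<le> 1 \<longrightarrow> norm x \<le> 1 \<longrightarrow>
          d < blinfun_apply g y \<longrightarrow> c < blinfun_apply f x \<longrightarrow>
          \<beta> \<le> blinfun_apply (blinfun_apply T y) x"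
        by blast
    qed
    ultimately show ?thesis ..
  qed
  then show ?thesis
    by (simp add: bc_eq_1_and_BCP)
qed

end
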